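(* Let $A\in\mathrm{GL}(n,\mathbb{D})$, where $\mathbb{D}=\mathbb{R}$ or $\mathbb{C}$. Then $A$ is reversible in $\mathrm{GL}(n,\mathbb{D})$ if and only if $A$ is strongly reversible in $\mathrm{GL}(n,\mathbb{D})$.
   Context: An element $g$ of a group $G$ is reversible in $G$ if $hgh^{-1}=g^{-1}$ for some $h\in G$; it is strongly reversible in $G$ if such an $h$ can be chosen to be an involution, i.e. an element of order at most two ($h^2=1$). *)

theory Defs
  imports "Jordan_Normal_Form.Matrix"
begin

definition GL :: "'a::field itself \<Rightarrow> nat \<Rightarrow> 'a mat monoid" where
  "GL T n = units_of (ring_mat T n ())"

lemma group_GL: "group (GL TYPE('a::field) n)"
  unfolding GL_def by (intro monoid.units_group ring.is_monoid ring_mat)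

lemma carrier_GL:
  "carrier (GL TYPE('a::field) n) = {A \<in> carrier_mat n n. invertible_mat A}"
  unfolding GL_def units_of_carrier Units_def ring_mat_simps invertible_mat_def inverts_mat_def
  by (auto simp: square_mat.simps) (metis carrier_matD carrier_matI index_mult_mat(2,3) index_one_mat(2,3))+

definition reversible_in :: "('a, 'b) monoid_scheme \<Rightarrow> 'a \<Rightarrow> bool" where
  "reversible_in G g \<longleftrightarrow>
     (\<exists>h\<in>carrier G. h \<otimes>\<^bsub>G\<^esub> g \<otimes>\<^bsub>G\<^esub> inv\<^bsub>G\<^esub> h = inv\<^bsub>G\<^esub> g)"

text \<open>An involution has order at most two, so the identity counts as one.\<close>

definition is_involution_in :: "('a, 'b) monoid_scheme \<Rightarrow> 'a \<Rightarrow> bool" where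
  "is_involution_in G h \<longleftrightarrow> h \<in> carrier G \<and> h [^]\<^bsub>G\<^esub> (2::nat) = \<one>\<^bsub>G\<^esub>"

definition strongly_reversible_in :: "('a, 'b) monoid_scheme \<Rightarrow> 'a \<Rightarrow> bool" where
  "strongly_reversible_in G g \<longleftrightarrow>
     (\<exists>h. is_involution_in G h \<and> h \<otimes>\<^bsub>G\<^esub> g \<otimes>\<^bsub>G\<^esub> inv\<^bsub>G\<^esub> h = inv\<^bsub>G\<^esub> g)"

end

(* Regard the space V as a K[x]-module through T and compare it with the module given by T' = T^-1.
   Reversibility makes dim ker q(T) = dim ker q(T') for every polynomial q, and this numerical
   condition, unlike similarity, is visibly inherited by complements, so an induction on dim V works
   without any normal form.  Choose v whose annihilator a kills all of V.  Then a(T') = 0 as well, so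
   p(T)v |-> p(T')v is a well-defined involution of the cyclic submodule W = K[T]v that carries T to T'.
   For a functional f vanishing on all T^i v with i < deg a - 1 but not on T^(deg a - 1) v, the set of
   u with f(p(T)u) = 0 for all p is an invariant complement of W, to which the induction applies. *)

theory Submission
  imports Defs "HOL-Computational_Algebra.Polynomial_Factorial"
    "HOL-Computational_Algebra.Field_as_Ring" "HOL-Library.Function_Algebras"
begin

section \<open>Polynomials in a linear operator\<close>

locale poly_action = vector_space scale
  for scale :: "'a::field \<Rightarrow> 'b::ab_group_add \<Rightarrow> 'b"
begin

text \<open>This is p(T) v in Horner form, so that recursion on \<open>pCons\<close> needs no powers
  of T. T is an arbitrary function here, which lets T and its inverse act side by side in one
  locale.\<close>

definition act :: "('b \<Rightarrow> 'b) \<Rightarrow> 'a poly \<Rightarrow> 'b \<Rightarrow> 'b" where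
  "act T p v = fold_coeffs (\<lambda>a w. scale a v + T w) p 0"

lemma act_0 [simp]: "act T 0 v = 0"
  by (simp add: act_def)

context
  fixes T :: "'b \<Rightarrow> 'b"
  assumes T: "Vector_Spaces.linear scale scale T"
begin

interpretation T: Vector_Spaces.linear scale scale T by (fact T)

lemma act_pCons: "act T (pCons a p) v = scale a v + T (act T p v)"
  by (cases "p = 0 \<and> a = 0") (auto simp: act_def)

lemma act_1 [simp]: "act T 1 v = v"
  by (simp add: one_pCons act_pCons)

lemma act_add: "act T (p + q) v = act T p v + act T q v"
  by (induction p q rule: poly_induct2)
    (simp_all add: act_pCons T.add scale_left_distrib)

lemma act_smult: "act T (smult c p) v = scale c (act T p v)"
  by (induction p) (simp_all add: act_pCons T.scale scale_right_distrib)

lemma act_mult: "act T (p * q) v = act T p (act T q v)"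
  by (induction p) (simp_all add: act_pCons act_add act_smult)

lemma act_diff: "act T (p - q) v = act T p v - act T q v"
  using act_add [of "p - q" q v] by (simp add: algebra_simps)

lemma act_sum: "act T (sum f A) v = (\<Sum>i\<in>A. act T (f i) v)"
  by (induction A rule: infinite_finite_induct) (simp_all add: act_add)

lemma linear_act_poly: "Vector_Spaces.linear smult scale (\<lambda>p. act T p v)"
  by (simp add: Vector_Spaces.linear_iff vector_space_axioms act_add act_smult)
    (unfold_locales, simp_all add: smult_add_left smult_add_right)

lemma linear_act: "Vector_Spaces.linear scale scale (act T p)"
proof -
  have "act T p (x + y) = act T p x + act T p y" for x y
    by (induction p) (simp_all add: act_pCons T.add scale_right_distrib)
  moreover have "act T p (scale c x) = scale c (act T p x)" for c x
    by (induction p) (simp_all add: act_pCons T.scale scale_right_distrib mult.commute)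
  ultimately show ?thesis
    by (simp add: Vector_Spaces.linear_iff vector_space_axioms)
qed

lemma
  shows act_right_0 [simp]: "act T p 0 = 0"
    and act_right_add: "act T p (x + y) = act T p x + act T p y"
    and act_right_scale: "act T p (scale c x) = scale c (act T p x)"
    and act_right_diff: "act T p (x - y) = act T p x - act T p y"
proof -
  interpret P: Vector_Spaces.linear scale scale "act T p" by (rule linear_act)
  show "act T p 0 = 0" "act T p (x + y) = act T p x + act T p y"
    "act T p (scale c x) = scale c (act T p x)" "act T p (x - y) = act T p x - act T p y"
    by (fact P.zero P.add P.scale P.diff)+
qed

lemma act_mod:
  assumes "act T a v = 0"
  shows "act T (p mod a) v = act T p v"
proof -
  have "act T p v = act T (p div a * a + p mod a) v"
    by simp
  also have "\<dots> = act T (p mod a) v"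
    using assms by (simp only: act_add act_mult act_right_0 add_0_left)
  finally show ?thesis by simp
qed

lemma act_closed:
  assumes "subspace S" "T ` S \<subseteq> S" "x \<in> S"
  shows "act T p x \<in> S"
  using assms by (induction p) (auto simp: act_pCons subspace_0 subspace_add subspace_scale)

lemma subspace_kernel_act:
  assumes "subspace S"
  shows "subspace {x \<in> S. act T p x = 0}"
proof -
  interpret P: Vector_Spaces.linear scale scale "act T p" by (rule linear_act)
  show ?thesis
    using assms by (auto simp: subspace_def P.add P.scale)
qed

end

text \<open>The relation between h, T and T' is asked only on the invariant subspace S, since the
  maps built later intertwine only there. Invariance keeps each Horner step inside S.\<close>

lemma act_intertwine:
  assumes T: "Vector_Spaces.linear scale scale T" and T': "Vector_Spaces.linear scale scale T'" and h: "Vector_Spaces.linear scale scale h"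
    and S: "subspace S" "T ` S \<subseteq> S"
    and hT: "\<And>x. x \<in> S \<Longrightarrow> h (T x) = T' (h x)" and x: "x \<in> S"
  shows "h (act T p x) = act T' p (h x)"
proof (induction p)
  case 0
  then show ?case by (simp add: module_hom.zero [OF Vector_Spaces.linear.axioms(3) [OF h]])
next
  case (pCons a p)
  then show ?case
    by (simp add: act_pCons [OF T] act_pCons [OF T'] hT act_closed [OF T S x]
        Vector_Spaces.linear_iff [THEN iffD1, OF h])
qed

section \<open>Dimensions, direct sums and conjugate operators\<close>

lemma dim_inj_image:
  assumes f: "Vector_Spaces.linear scale scale f" and S: "subspace S" "inj_on f S"
  shows "dim (f ` S) = dim S"
proof -
  interpret f: Vector_Spaces.linear scale scale f by (fact f)
  obtain B where B: "B \<subseteq> S" "independent B" "S \<subseteq> span B" "card B = dim S"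
    using basis_exists by blast
  then have "span B = S"
    using S(1) span_subspace by blast
  then show ?thesis
    using B S(2) f.span_image [of B] f.independent_injective_image [of B]
    by (metis card_image dim_span_eq_card_independent inj_on_subset)
qed

text \<open>A relation on B \<union> C splits into a part in X and its negative in Y; both lie in X
  \<inter> Y and so vanish separately. The finite set F stands for finite dimension, as the ambient
  space of the application is infinite dimensional.\<close>

lemma direct_sum_bases:
  assumes X: "subspace X" and Y: "subspace Y" and XY: "X \<inter> Y \<subseteq> {0}"
    and F: "X \<subseteq> span F" "Y \<subseteq> span F" "finite F"
  obtains B C where "span B = X" "span C = Y" "finite B" "finite C" "B \<inter> C = {}"
    "independent (B \<union> C)"
proof -
  obtain B where B: "B \<subseteq> X" "independent B" "X \<subseteq> span B" "card B = dim X"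
    using basis_exists by blast
  obtain C where C: "C \<subseteq> Y" "independent C" "Y \<subseteq> span C" "card C = dim Y"
    using basis_exists by blast
  have sB: "span B = X" and sC: "span C = Y"
    using B C X Y span_subspace by blast+
  have fin: "finite B" "finite C"
    using B C F independent_span_bound by (metis subset_trans)+
  have disj: "B \<inter> C = {}"
    using B C XY dependent_zero by blast
  have ind: "independent (B \<union> C)"
  proof (rule independent_if_scalars_zero)
    fix u x assume eq: "(\<Sum>x\<in>B \<union> C. scale (u x) x) = 0" and x: "x \<in> B \<union> C"
    let ?b = "\<Sum>x\<in>B. scale (u x) x" and ?c = "\<Sum>x\<in>C. scale (u x) x"
    have s: "?b + ?c = 0"
      using eq sum.union_disjoint [OF fin disj, of "\<lambda>x. scale (u x) x"] by simp
    have b: "?b \<in> X" and c: "?c \<in> Y"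
      using B(1) C(1) X Y by (auto intro!: subspace_sum subspace_scale)
    have "?b = - ?c" using s by (simp add: eq_neg_iff_add_eq_0)
    with b c have "?b \<in> X \<inter> Y" using subspace_neg [OF Y c] by simp
    then have "?b = 0" using XY by blast
    with s have "?b = 0" "?c = 0" by auto
    then show "u x = 0"
      using x independentD [OF B(2) fin(1) subset_refl] independentD [OF C(2) fin(2) subset_refl]
      by blast
  qed (use fin in simp)
  show thesis
    by (rule that [OF sB sC fin disj ind])
qed

lemma dim_direct_sum:
  assumes X: "subspace X" and Y: "subspace Y" and XY: "X \<inter> Y \<subseteq> {0}"
    and Z: "Z = {x + y |x y. x \<in> X \<and> y \<in> Y}" "Z \<subseteq> span F" "finite F"
  shows "dim Z = dim X + dim Y"
proof -
  have "X \<subseteq> span F" "Y \<subseteq> span F"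
    using subspace_0 [OF X] subspace_0 [OF Y] Z(2) unfolding Z(1) by force+
  then obtain B C where BC: "span B = X" "span C = Y" "finite B" "finite C" "B \<inter> C = {}"
      "independent (B \<union> C)"
    using direct_sum_bases [OF X Y XY _ _ Z(3)] by blast
  then have "span (B \<union> C) = Z"
    by (simp add: span_Un Z(1))
  then have "dim Z = card B + card C"
    using dim_span_eq_card_independent [OF BC(6)] BC by (simp add: card_Un_disjoint)
  moreover have "independent B" "independent C"
    using independent_mono [OF BC(6)] by auto
  ultimately show ?thesis
    using dim_span_eq_card_independent BC(1,2) by metis
qed

text \<open>Prescribe h on a joint basis of X and Y. Maps are linear on the whole ambient space, but
  only their restrictions to the subspaces matter.\<close>

lemma linear_glue:
  assumes X: "subspace X" and Y: "subspace Y" and XY: "X \<inter> Y \<subseteq> {0}"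
    and F: "X \<subseteq> span F" "Y \<subseteq> span F" "finite F"
    and f: "Vector_Spaces.linear scale scale f" and g: "Vector_Spaces.linear scale scale g"
  obtains h where "Vector_Spaces.linear scale scale h"
    "\<And>x. x \<in> X \<Longrightarrow> h x = f x" "\<And>y. y \<in> Y \<Longrightarrow> h y = g y"
proof -
  interpret VP: vector_space_pair scale scale ..
  obtain B C where BC: "span B = X" "span C = Y" "B \<inter> C = {}" "independent (B \<union> C)"
    using direct_sum_bases [OF X Y XY F] by blast
  obtain h where h: "Vector_Spaces.linear scale scale h"
      "\<And>x. x \<in> B \<union> C \<Longrightarrow> h x = (if x \<in> B then f x else g x)"
    using VP.linear_independent_extend [OF BC(4), of "\<lambda>x. if x \<in> B then f x else g x"] by blast
  show thesis
  proof (rule that)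
    show "h x = f x" if "x \<in> X" for x
      using that h(2) by (intro VP.linear_eq_on [OF h(1) f, of x B]) (auto simp: BC)
    show "h y = g y" if "y \<in> Y" for y
      using that h(2) disjoint_iff [THEN iffD1, OF BC(3)]
      by (intro VP.linear_eq_on [OF h(1) g, of y C]) (auto simp: BC(2))
  qed (fact h)
qed

lemma subspace_eq_if_dim_eq:
  assumes X: "subspace X" "X \<subseteq> V" and V: "V \<subseteq> span F" "finite F"
    and eq: "dim X = dim V"
  shows "X = V"
proof (rule ccontr)
  assume "X \<noteq> V"
  then obtain x where x: "x \<in> V" "x \<notin> X"
    using X by blast
  obtain B where B: "B \<subseteq> X" "independent B" "X \<subseteq> span B" "card B = dim X"
    using basis_exists by blast
  obtain C where C: "C \<subseteq> V" "independent C" "V \<subseteq> span C" "card C = dim V"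
    using basis_exists by blast
  have finC: "finite C"
    using independent_span_bound [OF V(2) C(2)] C(1) V(1) by simp
  have "x \<notin> span B"
    using span_subspace [OF B(1,3) X(1)] x by simp
  then have "independent (insert x B)"
    using B by (simp add: independent_insertI)
  moreover have "insert x B \<subseteq> span C"
    using B(1) X(2) x(1) C(3) by auto
  ultimately have "finite (insert x B) \<and> card (insert x B) \<le> card C"
    by (rule independent_span_bound [OF finC])
  moreover have "x \<notin> B"
    using B(1) x(2) by auto
  ultimately show False
    using B(4) C(4) eq by (auto simp: card_insert_if)
qed

text \<open>On V the maps h and k are mutually inverse intertwiners, so h carries the kernel of q(T)
  onto that of q(T'). It serves twice: for a conjugating matrix, and with h = k for the involution
  of a cyclic subspace.\<close>

lemma kernel_dim_eq_if_conjugate: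
  assumes T: "Vector_Spaces.linear scale scale T" and T': "Vector_Spaces.linear scale scale T'"
    and V: "subspace V" "T ` V \<subseteq> V" "T' ` V \<subseteq> V"
    and h: "Vector_Spaces.linear scale scale h" "\<And>x. x \<in> V \<Longrightarrow> h (T x) = T' (h x)"
      "\<And>x. x \<in> V \<Longrightarrow> h x \<in> V"
    and k: "Vector_Spaces.linear scale scale k" "\<And>x. x \<in> V \<Longrightarrow> k (T' x) = T (k x)"
      "\<And>x. x \<in> V \<Longrightarrow> k x \<in> V"
    and inv: "\<And>x. x \<in> V \<Longrightarrow> k (h x) = x" "\<And>x. x \<in> V \<Longrightarrow> h (k x) = x"
  shows "dim {x \<in> V. act T q x = 0} = dim {x \<in> V. act T' q x = 0}"
proof -
  interpret h: Vector_Spaces.linear scale scale h by (fact h(1))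
  interpret k: Vector_Spaces.linear scale scale k by (fact k(1))
  have hq: "h (act T q x) = act T' q (h x)" if "x \<in> V" for x
    by (rule act_intertwine [OF T T' h(1) V(1,2) h(2) that])
  have kq: "k (act T' q x) = act T q (k x)" if "x \<in> V" for x
    by (rule act_intertwine [OF T' T k(1) V(1,3) k(2) that])
  have "{x \<in> V. act T' q x = 0} = h ` {x \<in> V. act T q x = 0}"
  proof (intro equalityI subsetI)
    fix x assume "x \<in> {x \<in> V. act T' q x = 0}"
    then show "x \<in> h ` {x \<in> V. act T q x = 0}"
      using inv(2) [of x] k(3) [of x] kq [of x] k.zero by (intro image_eqI [of _ _ "k x"]) auto
  next
    fix x assume "x \<in> h ` {x \<in> V. act T q x = 0}"
    then obtain y where "x = h y" "y \<in> V" "act T q y = 0"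
      by auto
    then show "x \<in> {x \<in> V. act T' q x = 0}"
      using h(3) [of y] hq [of y] h.zero by auto
  qed
  moreover have "inj_on h {x \<in> V. act T q x = 0}"
    using inv(1) by (intro inj_on_inverseI [of _ k]) auto
  ultimately show ?thesis
    using dim_inj_image [OF h(1) subspace_kernel_act [OF T V(1)]] by simp
qed

section \<open>Annihilators and complements of cyclic subspaces\<close>

lemma annihilating_poly_exists:
  assumes T: "Vector_Spaces.linear scale scale T" and V: "subspace V" "T ` V \<subseteq> V"
    and F: "V \<subseteq> span F" "finite F" and v: "v \<in> V"
  shows "\<exists>q. q \<noteq> 0 \<and> degree q \<le> card F \<and> act T q v = 0"
proof -
  define N where "N = card F"
  define g where "g i = act T (monom 1 i) v" for i
  have g: "g i \<in> span F" for i
    using act_closed [OF T V v] F by (auto simp: g_def)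
  show ?thesis
  \<comment> \<open>Independence of a set does not see repetitions. Equal iterates are therefore
    handled by a difference of monomials; otherwise there are N + 1 distinct vectors in a span of N,
    hence a dependency.\<close>
  proof (cases "inj_on g {..N}")
    case False
    then obtain i j where ij: "i \<le> N" "j \<le> N" "i \<noteq> j" "g i = g j"
      by (auto simp: inj_on_def)
    define q :: "'a poly" where "q = monom 1 i - monom 1 j"
    have "coeff q i = 1"
      using ij by (simp add: q_def)
    then have "q \<noteq> 0"
      by auto
    moreover have "degree q \<le> N"
      unfolding q_def using ij by (intro degree_diff_le) (auto simp: degree_monom_eq)
    moreover have "act T q v = 0"
      using ij by (simp add: q_def act_diff [OF T] g_def)
    ultimately show ?thesis
      by (auto simp: N_def)
  next
    case True
    have "\<not> independent (g ` {..N})"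
    proof
      assume "independent (g ` {..N})"
      then have "card (g ` {..N}) \<le> card F"
        using independent_span_bound [OF F(2)] g by blast
      with True show False
        by (simp add: card_image N_def)
    qed
    then obtain u i where u: "i \<le> N" "u (g i) \<noteq> 0" "(\<Sum>x\<in>g ` {..N}. scale (u x) x) = 0"
      by (auto simp: dependent_finite)
    define q where "q = (\<Sum>i\<le>N. monom (u (g i)) i)"
    have c: "coeff q k = (if k \<le> N then u (g k) else 0)" for k
      by (simp add: q_def coeff_sum)
    have "q \<noteq> 0"
      using c [of i] u by auto
    moreover have "degree q \<le> N"
      by (intro degree_le) (simp add: c)
    moreover have "act T q v = 0"
    proof -
      have "act T (monom (u (g i)) i) v = scale (u (g i)) (g i)" for i
        by (simp add: g_def smult_monom flip: act_smult [OF T])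
      then have "act T q v = (\<Sum>i\<le>N. scale (u (g i)) (g i))"
        by (simp add: q_def act_sum [OF T])
      also have "\<dots> = 0"
        using u(3) True by (simp add: sum.reindex)
      finally show ?thesis .
    qed
    ultimately show ?thesis
      by (auto simp: N_def)
  qed
qed

text \<open>The polynomial generates the annihilator ideal of v. It is not normalised, and it is 0
  if only 0 kills v, so \<open>a \<noteq> 0\<close> is always carried along.\<close>

definition annihilator_gen :: "('b \<Rightarrow> 'b) \<Rightarrow> 'b \<Rightarrow> 'a poly \<Rightarrow> bool" where
  "annihilator_gen T v a \<longleftrightarrow> (\<forall>q. act T q v = 0 \<longleftrightarrow> a dvd q)"

text \<open>A nonzero killing polynomial of least degree divides all others, since a nonzero
  remainder would have smaller degree. The degree bound later allows a maximal choice.\<close>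

lemma annihilator_gen_exists:
  assumes T: "Vector_Spaces.linear scale scale T" and V: "subspace V" "T ` V \<subseteq> V"
    and F: "V \<subseteq> span F" "finite F" and v: "v \<in> V"
  obtains a where "a \<noteq> 0" "degree a \<le> card F" "annihilator_gen T v a"
proof -
  let ?P = "\<lambda>q. q \<noteq> 0 \<and> degree q \<le> card F \<and> act T q v = 0"
  obtain a where a: "?P a" and min: "\<And>q. ?P q \<Longrightarrow> degree a \<le> degree q"
    using ex_has_least_nat [of ?P _ degree] annihilating_poly_exists [OF assms] by metis
  interpret T: Vector_Spaces.linear scale scale T by (fact T)
  have "annihilator_gen T v a"
    unfolding annihilator_gen_def
  proof safe
    fix q assume q: "act T q v = 0"
    have "act T (q mod a) v = 0"
      using q a act_mod [OF T] by simp
    then show "a dvd q"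
      using degree_mod_less' [of a q] min [of "q mod a"] a by fastforce
  next
    fix q assume "a dvd q"
    then obtain r where "q = r * a"
      by (metis dvdE mult.commute)
    then show "act T q v = 0"
      using a by (simp add: act_mult [OF T] act_right_0 [OF T])
  qed
  with a that show thesis by blast
qed

text \<open>The cyclic space W of v is K[x]/(a), and the pairing of p with x to f(p(T) x) is
  nondegenerate on it, so U meets W only in 0. As a(T) = 0 on V, only d = deg a conditions define U,
  and d parameters in W can meet them. The map \<psi> is returned because it later defines the
  involution on W.\<close>

lemma invariant_complement:
  assumes T: "Vector_Spaces.linear scale scale T" and V: "subspace V" "T ` V \<subseteq> V"
    and v: "v \<in> V" "v \<noteq> 0"
    and a: "a \<noteq> 0" "annihilator_gen T v a" and aV: "\<And>x. x \<in> V \<Longrightarrow> act T a x = 0"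
  obtains U \<psi> where "subspace U" "T ` U \<subseteq> U" "range (\<lambda>p. act T p v) \<inter> U \<subseteq> {0}"
    "V = {w + u |w u. w \<in> range (\<lambda>p. act T p v) \<and> u \<in> U}"
    "Vector_Spaces.linear scale smult \<psi>" "\<And>p. \<psi> (act T p v) = p mod a"
proof -
  interpret P: Vector_Spaces.linear smult scale "\<lambda>p. act T p v"
    by (rule linear_act_poly [OF T])
  have smult: "Modules.module (smult :: 'a \<Rightarrow> 'a poly \<Rightarrow> 'a poly)"
    using Vector_Spaces.linear.axioms(1) [OF linear_act_poly [OF T]] by (simp add: Vector_Spaces.module_iff_vector_space)
  interpret PP: vector_space_pair smult scale ..
  interpret T: Vector_Spaces.linear scale scale T by (fact T)
  define d where "d = degree a"
  \<comment> \<open>Needed twice: for d = 0 the set D would miss even the zero polynomial, and the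
    truncated d - 1 would not be below d.\<close>
  have "d \<noteq> 0"
  proof
    assume "d = 0"
    then have "a dvd 1"
      using a by (simp add: d_def is_unit_iff_degree)
    then have "act T 1 v = 0"
      using a by (simp add: annihilator_gen_def)
    with v show False
      by (simp add: act_1 [OF T])
  qed
  define D where "D = {p :: 'a poly. degree p < d}"
  have D: "Modules.module.subspace smult D"
    using \<open>d \<noteq> 0\<close> by (auto simp: Modules.module.subspace_def [OF smult] D_def degree_add_less intro: le_less_trans [OF degree_smult_le])
  have "inj_on (\<lambda>p. act T p v) D"
  proof (rule inj_onI)
    fix p q assume pq: "p \<in> D" "q \<in> D" "act T p v = act T q v"
    then have "act T (p - q) v = 0"
      by (simp add: act_diff [OF T])
    then have "a dvd p - q"
      using a by (simp add: annihilator_gen_def)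
    moreover have "degree (p - q) < d"
      using pq by (simp add: D_def degree_diff_less)
    ultimately show "p = q"
      using dvd_imp_degree_le [of a "p - q"] by (fastforce simp: d_def)
  qed
  \<comment> \<open>Only the values of \<psi> on W are determined. Any linear extension to the whole
    space yields a complement.\<close>
  then obtain \<psi> where \<psi>: "Vector_Spaces.linear scale smult \<psi>" "\<And>p. p \<in> D \<Longrightarrow> \<psi> (act T p v) = p"
    using PP.linear_exists_left_inverse_on [OF P.linear_axioms D] by blast
  have mod: "act T p x = act T (p mod a) x" if "x \<in> V" for p x
    using act_mod [OF T aV [OF that]] by simp
  have modD: "p mod a \<in> D" for p
    using \<open>d \<noteq> 0\<close> degree_mod_less' [OF a(1), of p] by (cases "p mod a = 0") (auto simp: D_def d_def)
  have \<psi>a: "\<psi> (act T p v) = p mod a" for p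
    using mod [OF v(1)] \<psi>(2) [OF modD] by metis
  interpret psi: Vector_Spaces.linear scale smult \<psi> by (fact \<psi>)
  \<comment> \<open>On W this functional kills T^i v for i < d - 1 and takes the value 1 at T^(d -
    1) v.\<close>
  define f where "f x = coeff (\<psi> x) (d - 1)" for x
  have f_add: "f (x + y) = f x + f y" and f_scale: "f (scale c x) = c * f x"
    and f_diff: "f (x - y) = f x - f y" for x y c
    by (simp_all add: f_def psi.add psi.scale psi.diff)
  have f_0: "f 0 = 0"
    by (simp add: f_def)
  have f_sum: "f (sum g A) = (\<Sum>i\<in>A. f (g i))" for g and A :: "nat set"
    by (induction A rule: infinite_finite_induct) (simp_all add: f_0 f_add)
  define U where "U = {u \<in> V. \<forall>p. f (act T p u) = 0}"
  show thesis
  proof (rule that)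
    show "subspace U"
      using V(1) by (auto simp: subspace_def U_def act_right_0 [OF T] act_right_add [OF T] act_right_scale [OF T] f_0 f_add f_scale)
    show "T ` U \<subseteq> U"
    proof clarify
      fix u assume u: "u \<in> U"
      have "act T p (T u) = act T (p * [:0, 1:]) u" for p
        by (simp only: act_mult [OF T]) (simp add: act_pCons [OF T])
      with u V(2) show "T u \<in> U"
        by (auto simp: U_def)
    qed
    show "range (\<lambda>p. act T p v) \<inter> U \<subseteq> {0}"
    proof safe
      fix p assume U: "act T p v \<in> U"
      define r where "r = p mod a"
      have r: "act T r v \<in> U" "degree r < d" "act T p v = act T r v"
        using U mod [OF v(1), of p] modD [of p] by (simp_all add: r_def D_def)
      have "r = 0"
      proof (rule ccontr)
        assume "r \<noteq> 0"
        \<comment> \<open>The shift by x^k moves the leading term of r to degree d - 1, where f sees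
          it without any reduction mod a.\<close>
        define k where "k = d - 1 - degree r"
        have deg: "degree (monom 1 k * r) = d - 1"
          using r \<open>r \<noteq> 0\<close> by (simp add: degree_mult_eq degree_monom_eq k_def)
        then have "\<psi> (act T (monom 1 k * r) v) = monom 1 k * r"
          using \<open>d \<noteq> 0\<close> by (intro \<psi>) (simp add: D_def)
        then have "f (act T (monom 1 k) (act T r v)) = lead_coeff (monom 1 k * r)"
          by (simp add: f_def deg flip: act_mult [OF T])
        moreover have "f (act T (monom 1 k) (act T r v)) = 0"
          using r(1) by (simp add: U_def)
        ultimately show False
          using \<open>r \<noteq> 0\<close> by simp
      qed
      then show "act T p v = 0"
        using r by simp
    qed
    show "V = {w + u |w u. w \<in> range (\<lambda>p. act T p v) \<and> u \<in> U}"
    proof (intro equalityI subsetI)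
      fix x assume x: "x \<in> V"
      \<comment> \<open>A triangular system: the condition at index k is repaired by a multiple of
        T^(d - 1 - k) v, which by \<open>fm\<close> leaves the conditions at smaller indices
        intact.\<close>
      have "\<exists>p. \<forall>i<k. f (act T (monom 1 i) (x - act T p v)) = 0" if "k \<le> d" for k
        using that
      proof (induction k)
        case (Suc k)
        then obtain p where p: "\<And>i. i < k \<Longrightarrow> f (act T (monom 1 i) (x - act T p v)) = 0"
          by auto
        define c where "c = f (act T (monom 1 k) (x - act T p v))"
        define q where "q = p + smult c (monom 1 (d - 1 - k))"
        have fm: "f (act T (monom 1 i * monom 1 (d - 1 - k)) v) = (if i = k then 1 else 0)" if "i \<le> k" for i
        proof -
          have "i + (d - 1 - k) < d"
            using that Suc.prems by linarith
          then have "\<psi> (act T (monom 1 (i + (d - 1 - k))) v) = monom 1 (i + (d - 1 - k))"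
            by (intro \<psi>) (simp add: D_def degree_monom_eq)
          then show ?thesis
            using that Suc.prems by (auto simp: f_def mult_monom)
        qed
        have "f (act T (monom 1 i) (x - act T q v)) = 0" if "i < Suc k" for i
        proof -
          have "act T (monom 1 i) (x - act T q v)
            = act T (monom 1 i) (x - act T p v) - scale c (act T (monom 1 i * monom 1 (d - 1 - k)) v)"
            by (simp add: q_def act_add [OF T] act_smult [OF T] act_mult [OF T] act_right_diff [OF T]
                act_right_add [OF T] act_right_scale [OF T])
          then show ?thesis
            using that fm [of i] p [of i] by (cases "i = k") (auto simp: f_diff f_scale c_def)
        qed
        then show ?case by blast
      qed simp
      then obtain p where p: "\<And>i. i < d \<Longrightarrow> f (act T (monom 1 i) (x - act T p v)) = 0"
        by auto
      define u where "u = x - act T p v"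
      have u: "u \<in> V"
        using x v V act_closed [OF T V v(1)] by (simp add: u_def subspace_diff)
      \<comment> \<open>Reduction mod a expresses q(T) u through T^i u with i < d, and these d
        conditions are already met.\<close>
      have "f (act T q u) = 0" for q
      proof -
        define r where "r = q mod a"
        have deg: "degree r < d"
          using modD by (simp add: r_def D_def)
        have "act T q u = act T (\<Sum>i\<le>degree r. smult (coeff r i) (monom 1 i)) u"
          using mod [OF u, of q] by (simp add: r_def smult_monom poly_as_sum_of_monoms)
        also have "f \<dots> = (\<Sum>i\<le>degree r. coeff r i * f (act T (monom 1 i) u))"
          by (simp add: act_sum [OF T] act_smult [OF T] f_sum f_scale)
        also have "\<dots> = 0"
          using p deg by (intro sum.neutral) (auto simp: u_def)
        finally show ?thesis .
      qed
      with u have "u \<in> U"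
        by (simp add: U_def)
      moreover have "x = act T p v + u"
        by (simp add: u_def)
      ultimately show "x \<in> {w + u |w u. w \<in> range (\<lambda>p. act T p v) \<and> u \<in> U}"
        by blast
    next
      fix x assume "x \<in> {w + u |w u. w \<in> range (\<lambda>p. act T p v) \<and> u \<in> U}"
      then show "x \<in> V"
        using act_closed [OF T V v(1)] V(1) by (auto simp: U_def intro!: subspace_add)
    qed
  qed (use \<psi> \<psi>a in auto)
qed

end

section \<open>A vector of maximal annihilator, and the induction on dimension\<close>

locale gcd_poly_action = poly_action scale
  for scale :: "'a::field_gcd \<Rightarrow> 'b::ab_group_add \<Rightarrow> 'b"
begin

text \<open>Take \<open>v\<close> with annihilator \<open>a\<close> of maximal degree. If the annihilator \<open>b\<close> of some \<open>w\<close> had a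
  prime \<open>p\<close> with a larger exponent \<open>k\<close> than the exponent \<open>i\<close> in \<open>a\<close>, then the \<open>p\<close>-free part of \<open>v\<close> plus
  the \<open>p\<close>-part of \<open>w\<close> would have annihilator \<open>p ^ k * (a div p ^ i)\<close>, of larger degree.\<close>

lemma maximal_annihilator:
  assumes T: "Vector_Spaces.linear scale scale T" and V: "subspace V" "T ` V \<subseteq> V"
    and F: "V \<subseteq> span F" "finite F"
  obtains v a where "v \<in> V" "a \<noteq> 0" "annihilator_gen T v a" "\<And>x. x \<in> V \<Longrightarrow> act T a x = 0"
proof -
  let ?P = "\<lambda>(v, a). v \<in> V \<and> a \<noteq> 0 \<and> annihilator_gen T v a"
  \<comment> \<open>All generators for one vector divide each other, so the bound for the one known
    to exist holds for every generator. A greatest degree exists only because of this bound.\<close>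
  have bound: "degree (snd z) < Suc (card F)" if Pz: "?P z" for z
  proof -
    obtain v a where z: "z = (v, a)" "v \<in> V" "annihilator_gen T v a"
      using Pz by (cases z) auto
    obtain b where "b \<noteq> 0" "degree b \<le> card F" "annihilator_gen T v b"
      using annihilator_gen_exists [OF T V F z(2)] by blast
    moreover from this z have "a dvd b"
      by (metis annihilator_gen_def dvd_refl)
    ultimately have "degree a \<le> card F"
      using dvd_imp_degree_le [of a b] by simp
    with z show ?thesis by simp
  qed
  obtain a0 where "?P (0, a0)"
    using annihilator_gen_exists [OF T V F subspace_0 [OF V(1)]] subspace_0 [OF V(1)] by auto
  moreover have "\<forall>z. ?P z \<longrightarrow> degree (snd z) < Suc (card F)"
    using bound by blast
  ultimately have "\<exists>z. ?P z \<and> (\<forall>y. ?P y \<longrightarrow> degree (snd y) \<le> degree (snd z))"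
    by (rule ex_has_greatest_nat)
  then obtain z where z: "?P z" and max: "\<And>y. ?P y \<Longrightarrow> degree (snd y) \<le> degree (snd z)"
    by blast
  obtain v a where va: "z = (v, a)" "v \<in> V" "a \<noteq> 0" "annihilator_gen T v a"
    using z by (cases z) auto
  have "act T a w = 0" if w: "w \<in> V" for w
  proof -
    obtain b where b: "b \<noteq> 0" "annihilator_gen T w b"
      using annihilator_gen_exists [OF T V F w] by blast
    have "b dvd a"
    \<comment> \<open>Polynomials over a field of sort \<open>field_gcd\<close> factor into primes,
      so divisibility is tested prime by prime.\<close>
    proof (rule multiplicity_le_imp_dvd [OF b(1)], rule ccontr)
      fix p :: "'a poly" assume p: "prime p" and less: "\<not> multiplicity p b \<le> multiplicity p a"
      define i k where "i = multiplicity p a" and "k = multiplicity p b"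
      have ik: "i < k"
        using less by (simp add: i_def k_def)
      have nu: "\<not> is_unit p" and p0: "p \<noteq> 0"
        using p by auto
      obtain a' where a': "a = p ^ i * a'" "\<not> p dvd a'"
        using multiplicity_decompose' [OF va(3) nu] by (auto simp: i_def)
      obtain b' where b': "b = p ^ k * b'" "\<not> p dvd b'"
        using multiplicity_decompose' [OF b(1) nu] by (auto simp: k_def)
      have cop: "coprime (p ^ k) a'"
        using p a'(2) by (simp add: prime_imp_coprime)
      define u where "u = act T (p ^ i) v + act T b' w"
      have kill1: "act T q (act T (p ^ i) v) = 0 \<longleftrightarrow> a' dvd q" for q
      proof -
        have "act T q (act T (p ^ i) v) = 0 \<longleftrightarrow> p ^ i * a' dvd p ^ i * q"
          using va(4) a'(1) by (simp add: annihilator_gen_def mult.commute flip: act_mult [OF T])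
        then show ?thesis using p0 by simp
      qed
      have kill2: "act T q (act T b' w) = 0 \<longleftrightarrow> p ^ k dvd q" for q
      proof -
        have "act T q (act T b' w) = 0 \<longleftrightarrow> p ^ k * b' dvd q * b'"
          using b(2) b'(1) by (simp add: annihilator_gen_def flip: act_mult [OF T])
        then show ?thesis using b b'(1) by auto
      qed
      have "act T q u = 0 \<longleftrightarrow> p ^ k * a' dvd q" for q
      proof
        assume q: "act T q u = 0"
        \<comment> \<open>Multiplying q by \<open>p ^ k\<close> kills the second summand of u and
          isolates the first; multiplying by \<open>a'\<close> does the opposite. Coprimality then
          removes the extra factor.\<close>
        have "act T (p ^ k * q) u = 0"
          using q by (simp add: act_mult [OF T] act_right_0 [OF T])
        moreover have "act T (p ^ k * q) (act T b' w) = 0"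
          by (simp add: kill2)
        ultimately have "a' dvd p ^ k * q"
          by (simp add: u_def act_right_add [OF T] kill1)
        then have 1: "a' dvd q"
          using cop by (metis coprime_commute coprime_dvd_mult_right_iff)
        have "act T (a' * q) u = 0"
          using q by (simp add: act_mult [OF T] act_right_0 [OF T])
        moreover have "act T (a' * q) (act T (p ^ i) v) = 0"
          by (simp add: kill1)
        ultimately have "p ^ k dvd a' * q"
          by (simp add: u_def act_right_add [OF T] kill2)
        then have "p ^ k dvd q"
          using cop by (metis coprime_dvd_mult_right_iff)
        with 1 cop show "p ^ k * a' dvd q"
          by (simp add: divides_mult)
      next
        assume "p ^ k * a' dvd q"
        then have "p ^ k dvd q" "a' dvd q"
          by (auto dest: dvd_mult_left dvd_mult_right)
        then show "act T q u = 0"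
          by (simp add: u_def act_right_add [OF T] kill1 [THEN iffD2] kill2 [THEN iffD2])
      qed
      then have "annihilator_gen T u (p ^ k * a')"
        by (simp add: annihilator_gen_def)
      moreover have "u \<in> V"
        using V va(2) w by (simp add: u_def subspace_add act_closed [OF T])
      moreover have "p ^ k * a' \<noteq> 0"
        using p0 va(3) a' by auto
      ultimately have "degree (p ^ k * a') \<le> degree a"
        using max [of "(u, p ^ k * a')"] va(1) by simp
      moreover have "degree p > 0"
        using nu p0 by (simp add: is_unit_iff_degree)
      ultimately show False
        using ik p0 a' va(3) by (auto simp: degree_mult_eq degree_power_eq)
    qed
    then show ?thesis
      using va(4) b(2) by (simp add: annihilator_gen_def)
  qed
  with va that show thesis by blast
qed

text \<open>V is an invariant subspace of a fixed ambient space so that the induction can pass to U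
  with the same T and T'. A conjugating map need not respect the splitting of V, whereas kernel
  dimensions can be subtracted.\<close>

theorem involution_if_kernel_dims_eq:
  assumes T: "Vector_Spaces.linear scale scale T" and T': "Vector_Spaces.linear scale scale T'"
    and inv: "\<And>x. T (T' x) = x" "\<And>x. T' (T x) = x"
    and V: "subspace V" "V \<subseteq> span F" "finite F" "T ` V \<subseteq> V" "T' ` V \<subseteq> V"
    and dims: "\<And>q. dim {x \<in> V. act T q x = 0} = dim {x \<in> V. act T' q x = 0}"
  shows "\<exists>h. Vector_Spaces.linear scale scale h \<and>
    (\<forall>x\<in>V. h x \<in> V \<and> h (h x) = x \<and> h (T x) = T' (h x))"
  using V dims
proof (induction "dim V" arbitrary: V rule: less_induct)
  case (less V)
  note V = less.prems(1,4) and V' = less.prems(1,5) and F = less.prems(2,3)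
  show ?case
  proof (cases "V = {0}")
    case True
    then show ?thesis
      by (intro exI [of _ "\<lambda>x. x"]) (auto simp: linear_ident module_hom.zero
          [OF Vector_Spaces.linear.axioms(3) [OF T]] module_hom.zero [OF Vector_Spaces.linear.axioms(3) [OF T']])
  next
    case False
    obtain v a where v: "v \<in> V" and a: "a \<noteq> 0" "annihilator_gen T v a"
      and aV: "\<And>x. x \<in> V \<Longrightarrow> act T a x = 0"
      using maximal_annihilator [OF T V F] by blast
    have "v \<noteq> 0"
    proof
      assume "v = 0"
      then have "a dvd 1"
        using a(2) by (simp add: annihilator_gen_def act_right_0 [OF T])
      then obtain c where "1 = c * a"
        by (metis dvdE mult.commute)
      then have "x = 0" if "x \<in> V" for x
        using aV [OF that] act_mult [OF T, of c a x] by (simp add: act_1 [OF T] act_right_0 [OF T])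
      with False subspace_0 [OF V(1)] show False
        by blast
    qed
    define W where "W = range (\<lambda>p. act T p v)"
    obtain U \<psi> where U: "subspace U" "T ` U \<subseteq> U" and WU: "W \<inter> U \<subseteq> {0}"
      and VWU: "V = {w + u |w u. w \<in> W \<and> u \<in> U}"
      and \<psi>: "Vector_Spaces.linear scale smult \<psi>" "\<And>p. \<psi> (act T p v) = p mod a"
      by (rule invariant_complement [OF T V v \<open>v \<noteq> 0\<close> a aV, folded W_def, OF _ that])
    interpret P: Vector_Spaces.linear smult scale "\<lambda>p. act T p v"
      by (rule linear_act_poly [OF T])
    have W: "subspace W"
      unfolding W_def by (rule P.subspace_image) simp
    have UV: "U \<subseteq> V" and WV: "W \<subseteq> V"
      using subspace_0 [OF W] subspace_0 [OF U(1)] unfolding VWU by force+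
    have TW: "T ` W \<subseteq> W"
    proof -
      have "T (act T p v) = act T (pCons 0 p) v" for p
        by (simp add: act_pCons [OF T])
      then show ?thesis
        by (auto simp: W_def)
    qed
    \<comment> \<open>The kernel of a(T) is V, so the kernel of a(T') has full dimension in
      V.\<close>
    have aV': "act T' a x = 0" if "x \<in> V" for x
    proof -
      have "{x \<in> V. act T a x = 0} = V"
        using aV by blast
      then have "{x \<in> V. act T' a x = 0} = V"
        using less.prems(6) [of a] F
        by (intro subspace_eq_if_dim_eq [OF subspace_kernel_act [OF T' V(1)]]) auto
      with that show ?thesis by blast
    qed
    \<comment> \<open>Otherwise a = x b, and injectivity of T would make b, of smaller degree, kill
      v.\<close>
    have "coeff a 0 \<noteq> 0"
    proof
      assume "coeff a 0 = 0"
      then obtain b where b: "a = pCons 0 b"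
        by (metis coeff_pCons_0 pCons_cases)
      then have "T' (T (act T b v)) = T' 0"
        using aV [OF v] by (simp add: act_pCons [OF T])
      then have "act T b v = 0"
        by (simp add: inv module_hom.zero [OF Vector_Spaces.linear.axioms(3) [OF T']])
      then have "a dvd b"
        using a(2) by (simp add: annihilator_gen_def)
      moreover have "b \<noteq> 0" "degree a = Suc (degree b)"
        using a(1) b by auto
      ultimately show False
        using dvd_imp_degree_le [of a b] by simp
    qed
    \<comment> \<open>Writing a = c + x b with c nonzero gives T' = - b(T) / c on V. Hence
      T-invariant subspaces of V, in particular W and U, are T'-invariant.\<close>
    have inverse_poly: "\<exists>r. \<forall>x\<in>V. T' x = act T r x"
    proof -
      obtain c b where ab: "a = pCons c b"
        by (cases a)
      then have "c \<noteq> 0"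
        using \<open>coeff a 0 \<noteq> 0\<close> by simp
      have "T' x = act T (smult (- inverse c) b) x" if "x \<in> V" for x
      proof -
        have "T' (scale c x + T (act T b x)) = T' 0"
          using aV [OF that] by (simp add: ab act_pCons [OF T])
        then have "scale c (T' x) + act T b x = 0"
          by (simp add: inv Vector_Spaces.linear_iff [THEN iffD1, OF T'] module_hom.zero [OF Vector_Spaces.linear.axioms(3) [OF T']])
        then have "act T b x = - scale c (T' x)"
          by (simp add: eq_neg_iff_add_eq_0 add.commute)
        then show ?thesis
          using \<open>c \<noteq> 0\<close> unfolding act_smult [OF T] by simp
      qed
      then show ?thesis by blast
    qed
    then obtain r where r: "\<And>x. x \<in> V \<Longrightarrow> T' x = act T r x"
      by blast
    have TW': "T' ` W \<subseteq> W"
      using WV act_closed [OF T W TW] r by auto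
    have TU': "T' ` U \<subseteq> U"
      using UV act_closed [OF T U] r by auto

    interpret P': Vector_Spaces.linear smult scale "\<lambda>p. act T' p v"
      by (rule linear_act_poly [OF T'])
    \<comment> \<open>Passing through reduced representatives makes \<open>hW\<close> linear at
      once; a(T') v = 0 then gives the value p(T') v for unreduced p as well.\<close>
    define hW where "hW = (\<lambda>p. act T' p v) \<circ> \<psi>"
    have hW: "Vector_Spaces.linear scale scale hW"
      unfolding hW_def using \<psi>(1) P'.linear_axioms by (rule Vector_Spaces.linear_compose)
    have hW_act: "hW (act T p v) = act T' p v" for p
      using act_mod [OF T' aV' [OF v]] by (simp add: hW_def \<psi>(2))
    have hWT: "hW (T x) = T' (hW x)" if "x \<in> W" for x
    proof -
      obtain p where "x = act T p v"
        using \<open>x \<in> W\<close> by (auto simp: W_def)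
      then show ?thesis
        using hW_act [of "pCons 0 p"] hW_act [of p] by (simp add: act_pCons [OF T] act_pCons [OF T'])
    qed
    have hWT': "hW (T' x) = T (hW x)" if "x \<in> W" for x
      using hWT [of "T' x"] that TW' inv by (metis image_subset_iff)
    have vW: "v \<in> W" and hv: "hW v = v"
      using hW_act [of 1] by (auto simp: W_def act_1 [OF T] act_1 [OF T'] intro: range_eqI [of _ _ 1])
    have hWW: "hW x \<in> W" if "x \<in> W" for x
      using that hW_act act_closed [OF T' W TW' vW] by (auto simp: W_def)
    have hh: "hW (hW x) = x" if x: "x \<in> W" for x
    proof -
      obtain p where p: "x = act T p v"
        using x by (auto simp: W_def)
      \<comment> \<open>As \<open>hW\<close> also carries T' to T and fixes v, a second application
        returns p(T') v to p(T) v.\<close>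
      have "hW (act T' p v) = act T p (hW v)"
        by (rule act_intertwine [OF T' T hW W TW' hWT' vW])
      then show ?thesis
        by (simp add: p hW_act hv)
    qed
    have dimsW: "dim {x \<in> W. act T q x = 0} = dim {x \<in> W. act T' q x = 0}" for q
      by (rule kernel_dim_eq_if_conjugate [OF T T' W TW TW' hW hWT hWW hW hWT' hWW hh hh])

    \<comment> \<open>For S leaving W and U invariant, the kernel of q(S) splits along W and U.
      Taking S = T and S = T' and subtracting the equal dimensions on W leaves the hypothesis for
      U.\<close>
    have kernel_dim: "dim {x \<in> V. act S q x = 0} = dim {x \<in> W. act S q x = 0} + dim {x \<in> U. act S q x = 0}"
      if S: "Vector_Spaces.linear scale scale S" "S ` W \<subseteq> W" "S ` U \<subseteq> U" for S q
    proof (rule dim_direct_sum [OF subspace_kernel_act subspace_kernel_act])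
      show "{x \<in> W. act S q x = 0} \<inter> {x \<in> U. act S q x = 0} \<subseteq> {0}"
        using WU by auto
      show "{x \<in> V. act S q x = 0} = {x + y |x y. x \<in> {x \<in> W. act S q x = 0} \<and> y \<in> {x \<in> U. act S q x = 0}}"
      proof (intro equalityI subsetI)
        fix x assume x: "x \<in> {x \<in> V. act S q x = 0}"
        then obtain w u where wu: "x = w + u" "w \<in> W" "u \<in> U"
          unfolding VWU by blast
        have "act S q w + act S q u = 0"
          using x wu by (simp add: act_right_add [OF S(1)])
        then have "act S q w = - act S q u"
          by (simp add: eq_neg_iff_add_eq_0)
        moreover have "act S q w \<in> W" "- act S q u \<in> U"
          using wu W U S by (auto intro!: act_closed subspace_neg)
        ultimately have "act S q w = 0"
          using WU by auto
        with wu x show "x \<in> {x + y |x y. x \<in> {x \<in> W. act S q x = 0} \<and> y \<in> {x \<in> U. act S q x = 0}}"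
          by (auto simp: act_right_add [OF S(1)])
      qed (auto simp: VWU act_right_add [OF S(1)])
      show "{x \<in> V. act S q x = 0} \<subseteq> span F"
        using F by auto
    qed (use S W U F in auto)
    have dimsU: "dim {x \<in> U. act T q x = 0} = dim {x \<in> U. act T' q x = 0}" for q
      using kernel_dim [OF T TW U(2), of q] kernel_dim [OF T' TW' TU', of q] dimsW [of q]
        less.prems(6) [of q] by simp
    have "dim W \<noteq> 0"
    proof
      assume "dim W = 0"
      moreover have "dim {0} = 0"
        by (rule dim_unique [of "{}"]) (auto simp: independent_empty)
      ultimately have "{0} = W"
        using W WV F by (intro subspace_eq_if_dim_eq [of _ _ F]) (auto simp: subspace_0)
      with vW \<open>v \<noteq> 0\<close> show False by blast
    qed
    then have "dim U < dim V"
      using dim_direct_sum [OF W U(1) WU VWU F] by simp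
    then obtain hU where hU: "Vector_Spaces.linear scale scale hU"
      and hU_inv: "\<And>x. x \<in> U \<Longrightarrow> hU x \<in> U \<and> hU (hU x) = x \<and> hU (T x) = T' (hU x)"
      using less.hyps [of U, OF _ U(1) _ F(2) U(2) TU' dimsU] UV F by blast

    have "W \<subseteq> span F" "U \<subseteq> span F"
      using UV WV F(1) by auto
    then obtain h where h: "Vector_Spaces.linear scale scale h"
      and hW_eq: "\<And>x. x \<in> W \<Longrightarrow> h x = hW x" and hU_eq: "\<And>x. x \<in> U \<Longrightarrow> h x = hU x"
      using linear_glue [OF W U(1) WU _ _ F(2) hW hU] by blast
    have "h x \<in> V \<and> h (h x) = x \<and> h (T x) = T' (h x)" if x: "x \<in> V" for x
    proof -
      obtain w u where wu: "x = w + u" "w \<in> W" "u \<in> U"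
        using x unfolding VWU by blast
      have hx: "h x = hW w + hU u"
        using wu hW_eq hU_eq by (simp add: Vector_Spaces.linear_iff [THEN iffD1, OF h])
      have "h x \<in> V"
        unfolding VWU hx using hWW [OF wu(2)] hU_inv [OF wu(3)] by blast
      moreover have "h (h x) = x"
        using wu hWW [OF wu(2)] hU_inv [OF wu(3)] hh [OF wu(2)]
        by (simp add: hx Vector_Spaces.linear_iff [THEN iffD1, OF h] hW_eq hU_eq)
      moreover have "h (T x) = T' (h x)"
      proof -
        have "T w \<in> W" "T u \<in> U"
          using wu TW U(2) by auto
        then have "h (T x) = hW (T w) + hU (T u)"
          by (simp add: wu(1) Vector_Spaces.linear_iff [THEN iffD1, OF T] Vector_Spaces.linear_iff [THEN iffD1, OF h] hW_eq hU_eq)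
        also have "\<dots> = T' (h x)"
          using hWT [OF wu(2)] hU_inv [OF wu(3)]
          by (simp add: hx Vector_Spaces.linear_iff [THEN iffD1, OF T'])
        finally show ?thesis .
      qed
      ultimately show ?thesis by blast
    qed
    with h show ?thesis by blast
  qed
qed

end

section \<open>Matrices as operators on coordinate functions\<close>

definition vec_scale :: "'a::field \<Rightarrow> (nat \<Rightarrow> 'a) \<Rightarrow> nat \<Rightarrow> 'a" where
  "vec_scale c f = (\<lambda>i. c * f i)"

lemma vector_space_vec_scale: "vector_space vec_scale"
  by unfold_locales (auto simp: vec_scale_def algebra_simps)

definition unit_fun :: "nat \<Rightarrow> nat \<Rightarrow> 'a::field" where
  "unit_fun j = (\<lambda>i. if i = j then 1 else 0)"

text \<open>The locale needs one type that is a group as a whole, while n is a variable; so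
  n-dimensional space becomes a subspace of all functions on \<open>nat\<close>.\<close>

definition vecs :: "nat \<Rightarrow> (nat \<Rightarrow> 'a::field) set" where
  "vecs n = {f. \<forall>i\<ge>n. f i = 0}"

text \<open>Acting as the identity beyond the first \<open>n\<close> coordinates makes the operator of an
  invertible matrix invertible on all of \<open>nat \<Rightarrow> 'a\<close>.\<close>

definition mat_op :: "'a::field mat \<Rightarrow> (nat \<Rightarrow> 'a) \<Rightarrow> nat \<Rightarrow> 'a" where
  "mat_op A f = (\<lambda>i. if i < dim_row A then \<Sum>j<dim_col A. A $$ (i, j) * f j else f i)"

lemma linear_mat_op: "Vector_Spaces.linear vec_scale vec_scale (mat_op A)"
  by (auto simp: Vector_Spaces.linear_iff vector_space_vec_scale mat_op_def vec_scale_def fun_eq_iff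
      algebra_simps sum.distrib sum_distrib_left)

lemma mat_op_mult:
  assumes "A \<in> carrier_mat n n" "B \<in> carrier_mat n n"
  shows "mat_op (A * B) f = mat_op A (mat_op B f)"
proof
  fix i
  have "(\<Sum>k<n. (\<Sum>j<n. A $$ (i, j) * B $$ (j, k)) * f k) = (\<Sum>j<n. A $$ (i, j) * (\<Sum>k<n. B $$ (j, k) * f k))"
    by (simp add: sum_distrib_left sum_distrib_right mult.assoc) (rule sum.swap)
  then show "mat_op (A * B) f i = mat_op A (mat_op B f) i"
    using assms by (simp add: mat_op_def scalar_prod_def lessThan_atLeast0 cong: sum.cong_simp)
qed

lemma mat_op_one [simp]: "mat_op (1\<^sub>m n) f = f"
  by (auto simp: mat_op_def fun_eq_iff if_distrib [of "\<lambda>x. x * _"] cong: if_cong)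

lemma mat_op_vecs: "A \<in> carrier_mat n n \<Longrightarrow> f \<in> vecs n \<Longrightarrow> mat_op A f \<in> vecs n"
  by (auto simp: vecs_def mat_op_def)

lemma unit_fun_vecs: "j < n \<Longrightarrow> unit_fun j \<in> vecs n"
  by (auto simp: vecs_def unit_fun_def)

lemma mat_eq_if_mat_op_eq:
  assumes A: "A \<in> carrier_mat n n" and B: "B \<in> carrier_mat n n"
    and eq: "\<And>f. f \<in> vecs n \<Longrightarrow> mat_op A f = mat_op B f"
  shows "A = B"
proof (rule eq_matI)
  fix i j assume "i < dim_row B" "j < dim_col B"
  then have ij: "i < n" "j < n"
    using B by auto
  have "mat_op C (unit_fun j) i = C $$ (i, j)" if "C \<in> carrier_mat n n" for C :: "'a mat"
    using ij that by (simp add: mat_op_def unit_fun_def if_distrib cong: if_cong)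
  then show "A $$ (i, j) = B $$ (i, j)"
    using eq [OF unit_fun_vecs [OF ij(2)]] A B by metis
qed (use A B in auto)

lemma vecs_expand:
  assumes "f \<in> vecs n"
  shows "f = (\<Sum>j<n. vec_scale (f j) (unit_fun j))"
proof
  fix i
  have "(\<Sum>j<n. vec_scale (f j) (unit_fun j)) i = (\<Sum>j<n. vec_scale (f j) (unit_fun j) i)"
    by (induction n) simp_all
  also have "\<dots> = f i"
    using assms by (simp add: vec_scale_def unit_fun_def vecs_def if_distrib cong: if_cong)
  finally show "f i = (\<Sum>j<n. vec_scale (f j) (unit_fun j)) i" by simp
qed

lemma mat_of_linear:
  assumes h: "Vector_Spaces.linear vec_scale vec_scale h" and V: "\<And>f. f \<in> vecs n \<Longrightarrow> h f \<in> vecs n"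
  obtains H :: "'a::field mat" where "H \<in> carrier_mat n n" "\<And>f. f \<in> vecs n \<Longrightarrow> mat_op H f = h f"
proof -
  interpret h: Vector_Spaces.linear vec_scale vec_scale h by (fact h)
  define H where "H = mat n n (\<lambda>(i, j). h (unit_fun j) i)"
  have "mat_op H f = h f" if f: "f \<in> vecs n" for f
  proof
    fix i
    have "h f = (\<Sum>j<n. vec_scale (f j) (h (unit_fun j)))"
      by (subst vecs_expand [OF f]) (simp add: h.sum h.scale)
    then have "h f i = (\<Sum>j<n. vec_scale (f j) (h (unit_fun j))) i"
      by (rule fun_cong)
    also have "\<dots> = (\<Sum>j<n. h (unit_fun j) i * f j)"
      by (induction n) (simp_all add: vec_scale_def mult.commute)
    finally show "mat_op H f i = h f i"
      using V [OF f] f by (auto simp: mat_op_def H_def vecs_def)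
  qed
  then show thesis
    by (intro that [of H]) (simp_all add: H_def)
qed

text \<open>The equation for H says that \<open>mat_op H\<close> intertwines the operators of A and
  A'. This yields equal kernel dimensions, and the resulting involution of \<open>vecs n\<close> is
  turned back into a matrix.\<close>

lemma matrix_strongly_reversible:
  fixes A :: "'a::field_gcd mat"
  assumes A: "A \<in> carrier_mat n n" and A': "A' \<in> carrier_mat n n" "A * A' = 1\<^sub>m n" "A' * A = 1\<^sub>m n"
    and H: "H \<in> carrier_mat n n" "H' \<in> carrier_mat n n" "H * H' = 1\<^sub>m n" "H' * H = 1\<^sub>m n"
    and HA: "H * A = A' * H"
  obtains S where "S \<in> carrier_mat n n" "S * S = 1\<^sub>m n" "S * A = A' * S"
proof -
  interpret gcd_poly_action "vec_scale :: 'a \<Rightarrow> (nat \<Rightarrow> 'a) \<Rightarrow> nat \<Rightarrow> 'a"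
    by (intro gcd_poly_action.intro poly_action.intro vector_space_vec_scale)
  let ?V = "vecs n :: (nat \<Rightarrow> 'a) set"
  have V: "subspace ?V"
    by (auto simp: subspace_def vecs_def vec_scale_def)
  have span: "?V \<subseteq> span (unit_fun ` {..<n})"
  proof
    fix f :: "nat \<Rightarrow> 'a" assume "f \<in> ?V"
    show "f \<in> span (unit_fun ` {..<n})"
      by (subst vecs_expand [OF \<open>f \<in> ?V\<close>]) (intro span_sum span_scale span_base, auto)
  qed
  \<comment> \<open>The conjugacy lemma asks for intertwining by the inverse map too.\<close>
  have H'A': "H' * A' = A * H'"
  proof -
    have "H' * A' = H' * (A' * H) * H'"
      using A' H by (simp add: assoc_mult_mat [of _ n n _ n _ n])
    also have "\<dots> = (H' * H) * (A * H')"
      unfolding HA [symmetric] using A H(1,2) by (simp add: assoc_mult_mat [of _ n n _ n _ n])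
    also have "\<dots> = A * H'"
      using A H by simp
    finally show ?thesis .
  qed
  have conj: "mat_op H (mat_op A x) = mat_op A' (mat_op H x)"
     "mat_op H' (mat_op A' x) = mat_op A (mat_op H' x)" for x
    using A A' H HA H'A' by (simp_all flip: mat_op_mult [of _ n])
  have inv: "mat_op H' (mat_op H x) = x" "mat_op H (mat_op H' x) = x"
     "mat_op A' (mat_op A x) = x" "mat_op A (mat_op A' x) = x" for x
    using A A' H by (simp_all flip: mat_op_mult [of _ n])
  have AV: "mat_op A ` ?V \<subseteq> ?V" "mat_op A' ` ?V \<subseteq> ?V"
    using A A' mat_op_vecs by blast+
  have "dim {x \<in> ?V. act (mat_op A) q x = 0} = dim {x \<in> ?V. act (mat_op A') q x = 0}" for q
    by (rule kernel_dim_eq_if_conjugate [of _ _ _ "mat_op H" "mat_op H'"])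
      (use V AV H in \<open>simp_all add: linear_mat_op conj inv mat_op_vecs\<close>)
  then obtain h where h: "Vector_Spaces.linear vec_scale vec_scale h"
    and h_inv: "\<And>x. x \<in> ?V \<Longrightarrow> h x \<in> ?V \<and> h (h x) = x \<and> h (mat_op A x) = mat_op A' (h x)"
    using involution_if_kernel_dims_eq [OF linear_mat_op linear_mat_op inv(4,3) V span _ AV] by blast
  obtain S where S: "S \<in> carrier_mat n n" and Sh: "\<And>f. f \<in> ?V \<Longrightarrow> mat_op S f = h f"
    using mat_of_linear [OF h] h_inv by blast
  show thesis
  proof (rule that [OF S])
    \<comment> \<open>Matrix identities need testing only on \<open>vecs n\<close>, where S acts as
      h.\<close>
    show "S * S = 1\<^sub>m n"
      using S h_inv Sh by (intro mat_eq_if_mat_op_eq [of _ n]) (simp_all add: mat_op_mult [of _ n])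
    show "S * A = A' * S"
      using S A A' h_inv Sh AV
      by (intro mat_eq_if_mat_op_eq [of _ n]) (auto simp: mat_op_mult [of _ n] image_subset_iff)
  qed
qed

section \<open>Transfer to the general linear group\<close>

lemma reversible_iff_strongly_reversible_GL:
  fixes A :: "'a::field_gcd mat"
  assumes A: "A \<in> carrier (GL TYPE('a) n)"
  shows "reversible_in (GL TYPE('a) n) A \<longleftrightarrow> strongly_reversible_in (GL TYPE('a) n) A"
proof
  interpret group "GL TYPE('a) n" by (rule group_GL)
  have mult: "x \<otimes>\<^bsub>GL TYPE('a) n\<^esub> y = x * y" and one: "\<one>\<^bsub>GL TYPE('a) n\<^esub> = 1\<^sub>m n" for x y
    by (simp_all add: GL_def units_of_def ring_mat_simps)
  have carr: "x \<in> carrier_mat n n" if "x \<in> carrier (GL TYPE('a) n)" for x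
    using that by (simp add: carrier_GL)
  let ?inv = "\<lambda>x. inv\<^bsub>GL TYPE('a) n\<^esub> x"
  {
    assume "reversible_in (GL TYPE('a) n) A"
    then obtain H where H: "H \<in> carrier (GL TYPE('a) n)"
      and HA: "H \<otimes>\<^bsub>GL TYPE('a) n\<^esub> A \<otimes>\<^bsub>GL TYPE('a) n\<^esub> ?inv H = ?inv A"
      by (auto simp: reversible_in_def)
    \<comment> \<open>Clearing the inverse of H from the group equation gives the matrix form used
      above; the same rewriting is read backwards for S.\<close>
    have "H * A = ?inv A * H"
      using HA H A by (metis inv_closed inv_solve_right m_closed mult)
    moreover have "A * ?inv A = 1\<^sub>m n" "?inv A * A = 1\<^sub>m n" "H * ?inv H = 1\<^sub>m n" "?inv H * H = 1\<^sub>m n"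
      using A H r_inv l_inv by (simp_all flip: mult one)
    ultimately obtain S where S: "S \<in> carrier_mat n n" "S * S = 1\<^sub>m n" "S * A = ?inv A * S"
      using matrix_strongly_reversible [of A n "?inv A" H "?inv H"] A H carr by auto
    \<comment> \<open>S is its own inverse matrix, hence invertible.\<close>
    have SG: "S \<in> carrier (GL TYPE('a) n)"
      using S by (auto simp: carrier_GL invertible_mat_def inverts_mat_def)
    then have "is_involution_in (GL TYPE('a) n) S"
      using S by (simp add: is_involution_in_def numeral_2_eq_2 mult one)
    moreover have "S \<otimes>\<^bsub>GL TYPE('a) n\<^esub> A \<otimes>\<^bsub>GL TYPE('a) n\<^esub> ?inv S = ?inv A"
      using S SG A by (metis inv_closed inv_solve_right m_closed mult)
    ultimately show "strongly_reversible_in (GL TYPE('a) n) A"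
      by (auto simp: strongly_reversible_in_def)
  }
qed (auto simp: reversible_in_def strongly_reversible_in_def is_involution_in_def)

theorem proposition5p2:
  fixes n :: nat
  shows "(\<forall>A \<in> carrier (GL TYPE(real) n).
            reversible_in (GL TYPE(real) n) A \<longleftrightarrow> strongly_reversible_in (GL TYPE(real) n) A)
       \<and> (\<forall>A \<in> carrier (GL TYPE(complex) n).
            reversible_in (GL TYPE(complex) n) A \<longleftrightarrow> strongly_reversible_in (GL TYPE(complex) n) A)"
  by (intro conjI ballI reversible_iff_strongly_reversible_GL)

end
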